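(* Suppose $n-|\tau_0|>4$. For any $\delta>0$ there exists a constant $\gamma_\delta\in(0,1)$ such that, when $$\lambda\in\Big[4n\gamma_\delta^{1/2}\Big\{2+2(|\tau_0|+1)\frac{\log(p/2)}{n}\Big\}\sigma_0^2,\ \frac{n\gamma_\delta^{1/4}}{6}C_{\min}\Big],$$ the candidate set $S^{(d)}$ satisfies, for every $d\ge 1$, $$\mathbb P_{(\mathcal U^d,Y)}\big(\tau_0\notin S^{(d)}\big)\le\Big(1-\frac{\gamma_\delta^{\,n-1}}{n-1}\Big)^d+\delta .$$ Therefore $\limsup_{d\to\infty}\mathbb P_{(\mathcal U^d,Y)}(\tau_0\notin S^{(d)})\le\delta$, where $\delta>0$ is arbitrarily small.
   Context: Setting. $n,p$ are positive integers and $X\in\mathbb R^{n\times p}$ is a fixed matrix. For $\tau\subset[p]=\{1,\dots,p\}$ (a "model"), $X_\tau$ is the submatrix of the columns of $X$ indexed by $\tau$ and $|\tau|$ is the cardinality. The data are $Y=X_{\tau_0}\beta_0+\sigma_0U$, where $\tau_0\subset[p]$ (nonempty), $\beta_0\in\mathbb R^{|\tau_0|}$, $\sigma_0>0$ are fixed and $U\sim N(0,I_n)$. Identifiability: $\tau_0$ is the unique model of smallest cardinality in $\{\tau\subset[p]: X_\tau\beta_\tau=X_{\tau_0}\beta_0\text{ for some }\beta_\tau\in\mathbb R^{|\tau|}\}$. Define $$C_{\min}=\min_{\tau\ne\tau_0,\ |\tau|\le|\tau_0|}\ \min_{\beta_\tau\in\mathbb R^{|\tau|}}\ \frac{\|X_{\tau_0}\beta_0-X_\tau\beta_\tau\|_2^2}{n\max(|\tau_0\setminus\tau|,1)},$$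 so that $C_{\min}>0$ by identifiability. Candidate set. Let $\mathcal U^d=(U_1^*,\dots,U_d^* )$ be i.i.d. $N(0,I_n)$, independent of $U$. For $\lambda>0$ let $$\hat\tau_b=\arg\min_{\tau\subset[p]}\ \min_{\beta_\tau\in\mathbb R^{|\tau|},\,\sigma\in\mathbb R}\big\{\|Y-X_\tau\beta_\tau-\sigma U_b^*\|_2^2+\lambda|\tau|\big\},\quad b=1,\dots,d$$ (with a fixed tie-breaking rule), and $S^{(d)}=\{\hat\tau_b:b=1,\dots,d\}$. $\mathbb P_{(\mathcal U^d,Y)}$ is the joint probability over $U$ and $\mathcal U^d$. *)

theory Defs
  imports "HOL-Probability.Probability"
begin

(* The sample size is n = CARD('n) and the number of covariates is p = CARD('p).  A model is a set
   tau :: 'p set.  A coefficient vector of R^|tau| is represented by a vector of R^p of which only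
   the coordinates in tau are used. *)

definition sub_mult :: "real ^ 'p ^ 'n \<Rightarrow> 'p set \<Rightarrow> real ^ 'p \<Rightarrow> real ^ 'n" where
  "sub_mult X \<tau> \<beta> = (\<Sum>j\<in>\<tau>. (\<beta> $ j) *\<^sub>R column j X)"

definition identifiable :: "real ^ 'p ^ 'n \<Rightarrow> 'p set \<Rightarrow> real ^ 'p \<Rightarrow> bool" where
  "identifiable X \<tau>0 \<beta>0 \<longleftrightarrow>
     (\<forall>\<tau>. is_arg_min card (\<lambda>\<tau>'. \<exists>\<beta>. sub_mult X \<tau>' \<beta> = sub_mult X \<tau>0 \<beta>0) \<tau> \<longleftrightarrow> \<tau> = \<tau>0)"

(* The infima over coefficients in C_min and criterion are attained: see C_min_inner_attained and
   criterion_attained below.  For nonempty tau0, C_min is a minimum over a nonempty set, because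
   the empty model competes. *)

definition C_min :: "real ^ 'p ^ 'n \<Rightarrow> 'p set \<Rightarrow> real ^ 'p \<Rightarrow> real" where
  "C_min X \<tau>0 \<beta>0 =
     Min ((\<lambda>\<tau>. INF \<beta>. (norm (sub_mult X \<tau>0 \<beta>0 - sub_mult X \<tau> \<beta>))\<^sup>2
                     / (real CARD('n) * real (max (card (\<tau>0 - \<tau>)) 1)))
          ` {\<tau>. \<tau> \<noteq> \<tau>0 \<and> card \<tau> \<le> card \<tau>0})"

definition criterion ::
  "real ^ 'p ^ 'n \<Rightarrow> real \<Rightarrow> real ^ 'n \<Rightarrow> real ^ 'n \<Rightarrow> 'p set \<Rightarrow> real" where
  "criterion X lam y ustar \<tau> =
     (INF (\<beta>, \<sigma>). (norm (y - sub_mult X \<tau> \<beta> - \<sigma> *\<^sub>R ustar))\<^sup>2 + lam * real (card \<tau>))"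

definition tie_breaking :: "('m set \<Rightarrow> 'm) \<Rightarrow> bool" where
  "tie_breaking sel \<longleftrightarrow> (\<forall>A. A \<noteq> {} \<longrightarrow> sel A \<in> A)"

definition tau_hat ::
  "('p set set \<Rightarrow> 'p set) \<Rightarrow> real ^ 'p ^ 'n \<Rightarrow> real \<Rightarrow> real ^ 'n \<Rightarrow> real ^ 'n \<Rightarrow> 'p set" where
  "tau_hat sel X lam y ustar = sel {\<tau>. is_arg_min (criterion X lam y ustar) (\<lambda>_. True) \<tau>}"

definition candidate_set ::
  "('p set set \<Rightarrow> 'p set) \<Rightarrow> real ^ 'p ^ 'n \<Rightarrow> real \<Rightarrow> real ^ 'n \<Rightarrow> nat \<Rightarrow> (nat \<Rightarrow> real ^ 'n)
     \<Rightarrow> 'p set set" where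
  "candidate_set sel X lam y d us = (\<lambda>b. tau_hat sel X lam y (us b)) ` {1..d}"

definition std_gaussian :: "(real ^ 'n) measure" where
  "std_gaussian = density lborel (\<lambda>x. ennreal (\<Prod>i\<in>UNIV. std_normal_density (x $ i)))"

(* The joint law of U and U_1^*, ..., U_d^*. *)

definition joint_law :: "nat \<Rightarrow> ((real ^ 'n) \<times> (nat \<Rightarrow> real ^ 'n)) measure" where
  "joint_law d = std_gaussian \<Otimes>\<^sub>M Pi\<^sub>M {1..d} (\<lambda>_. std_gaussian)"

definition prob_miss ::
  "('p set set \<Rightarrow> 'p set) \<Rightarrow> real ^ 'p ^ 'n \<Rightarrow> 'p set \<Rightarrow> real ^ 'p \<Rightarrow> real \<Rightarrow> real \<Rightarrow> nat \<Rightarrow> real"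
  where
  "prob_miss sel X \<tau>0 \<beta>0 \<sigma>0 lam d =
     measure (joint_law d)
       {(u, us) \<in> space (joint_law d).
          \<tau>0 \<notin> candidate_set sel X lam (sub_mult X \<tau>0 \<beta>0 + \<sigma>0 *\<^sub>R u) d us}"

lemma subspace_nearest:
  fixes f :: "'a::euclidean_space \<Rightarrow> 'b::euclidean_space"
  assumes "linear f"
  shows "\<exists>x. \<forall>z. norm (y - f x) \<le> norm (y - f z)"
proof -
  have "closed (range f)"
    using assms by (intro closed_subspace linear_subspace_image subspace_UNIV)
  then obtain v where "v \<in> range f" "\<And>w. w \<in> range f \<Longrightarrow> dist y v \<le> dist y w"
    using distance_attains_inf[of "range f" y] by blast
  then show ?thesis by (auto simp: dist_norm)
qed

lemma INF_attained:
  fixes g :: "'a \<Rightarrow> real"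
  assumes "\<And>z. g x \<le> g z"
  shows "(INF z. g z) = g x"
  using assms by (intro cInf_eq_minimum) auto

lemma linear_sub_mult: "linear (sub_mult X \<tau>)"
  by (rule linearI)
     (auto simp: sub_mult_def scaleR_add_left sum.distrib scaleR_sum_right)

lemma C_min_inner_attained:
  fixes c :: real
  assumes "c \<ge> 0"
  shows "\<exists>\<beta>. (INF \<beta>'. (norm (y - sub_mult X \<tau> \<beta>'))\<^sup>2 / c) = (norm (y - sub_mult X \<tau> \<beta>))\<^sup>2 / c"
proof -
  obtain \<beta> where "\<And>z. norm (y - sub_mult X \<tau> \<beta>) \<le> norm (y - sub_mult X \<tau> z)"
    using subspace_nearest[OF linear_sub_mult] by blast
  then show ?thesis
    using assms by (intro exI[of _ \<beta>] INF_attained divide_right_mono power_mono) auto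
qed

lemma criterion_attained:
  "\<exists>\<beta> \<sigma>. criterion X lam y ustar \<tau>
          = (norm (y - sub_mult X \<tau> \<beta> - \<sigma> *\<^sub>R ustar))\<^sup>2 + lam * real (card \<tau>)"
proof -
  let ?f = "\<lambda>(\<beta>, \<sigma>::real). sub_mult X \<tau> \<beta> + \<sigma> *\<^sub>R ustar"
  have "linear ?f"
    by (rule linearI)
       (auto simp: linear_add[OF linear_sub_mult] linear_scale[OF linear_sub_mult] algebra_simps)
  then obtain x where "\<And>z. norm (y - ?f x) \<le> norm (y - ?f z)"
    using subspace_nearest by blast
  then have "(INF z. (norm (y - ?f z))\<^sup>2 + lam * real (card \<tau>))
           = (norm (y - ?f x))\<^sup>2 + lam * real (card \<tau>)"
    by (intro INF_attained add_right_mono power_mono) auto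
  then show ?thesis
    by (cases x) (auto simp: criterion_def case_prod_beta diff_diff_eq)
qed

end

theory Submission imports Defs begin

(* The constant gamma may depend on everything except lambda and d, so take gamma = r^2 with r small.
   Write mu = X_tau0 beta0.  For a competing tau with |tau| <= |tau0|, identifiability keeps mu away
   from the range of X_tau, and span(mu, X_tau) is a proper subspace, hence Gaussian-null.  So there
   is a compact K with P(U in K) >= 1 - delta at positive distance from all these spans.  If u is in K
   and |U*_b - u| <= r, the residual of every such tau stays above some kappa > 0 (if
   mu + sigma0 u were close to X_tau beta + sigma U*_b, then either sigma is far from sigma0 and u is
   close to span(mu, X_tau), or mu is close to range X_tau), while that of tau0 is at most sigma0 r.
   With lambda between orders r and sqrt r, larger models lose by the penalty and the others by
   kappa^2, so tau_hat_b = tau0.  Finally P(|U*_b - u| <= r) >= C r^n, which exceeds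
   gamma^(n-1)/(n-1) for r small since 2(n-1) > n, and the b are independent given U = u. *)

section \<open>The standard Gaussian measure: total mass, small balls, inner regularity\<close>

lemma sets_std_gaussian [measurable_cong, simp]: "sets std_gaussian = sets borel"
  by (simp add: std_gaussian_def)

lemma space_std_gaussian [simp]: "space std_gaussian = UNIV"
  by (simp add: std_gaussian_def)

text \<open>The density is a product over coordinates, so its integral splits into one-dimensional
  normal integrals, each equal to 1.\<close>

lemma prob_space_std_gaussian: "prob_space (std_gaussian :: (real ^ 'n) measure)"
proof
  \<comment> \<open>Lebesgue measure factors over \<open>Basis\<close>, so the product over the
    index type is first reindexed along \<open>axis i 1\<close>.\<close>
  have eq: "ennreal (\<Prod>i\<in>UNIV. std_normal_density (x $ i))
      = (\<Prod>b\<in>Basis. ennreal (std_normal_density (x \<bullet> b)))" for x :: "real ^ 'n"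
  proof -
    have "(\<Prod>b\<in>Basis. ennreal (std_normal_density (x \<bullet> b)))
        = (\<Prod>i\<in>UNIV. ennreal (std_normal_density (x \<bullet> axis i 1)))"
      by (intro prod.reindex_cong[of "\<lambda>i. axis i 1"])
         (auto simp: Basis_vec_def inj_on_def axis_eq_axis)
    then show ?thesis
      by (simp add: inner_axis prod_ennreal)
  qed
  have "emeasure std_gaussian (space (std_gaussian :: (real ^ 'n) measure))
      = (\<integral>\<^sup>+x. (\<Prod>b\<in>Basis. ennreal (std_normal_density (x \<bullet> b))) \<partial>(lborel :: (real ^ 'n) measure))"
    by (simp add: std_gaussian_def emeasure_density eq)
  also have "\<dots> = (\<Prod>b\<in>(Basis :: (real ^ 'n) set). \<integral>\<^sup>+x. ennreal (std_normal_density x) \<partial>lborel)"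
    by (rule nn_integral_lborel_prod) auto
  also have "(\<integral>\<^sup>+x. ennreal (std_normal_density x) \<partial>lborel) = 1"
    using prob_space.emeasure_space_1[OF prob_space_normal_density[of 1 0]]
    by (simp add: emeasure_density)
  finally show "emeasure std_gaussian (space (std_gaussian :: (real ^ 'n) measure)) = 1"
    by simp
qed

text \<open>On the ball every coordinate is at most \<open>R + 1\<close> in absolute value, so the
  density is bounded below by a constant that depends on \<open>R\<close> but not on the centre. One
  constant therefore serves all centres in a bounded set.\<close>

lemma std_gaussian_cball_ge:
  fixes u :: "real ^ 'n"
  assumes "norm u \<le> R" "0 \<le> r" "r \<le> 1"
  shows "std_normal_density (R + 1) ^ CARD('n) * unit_ball_vol (real CARD('n)) * r ^ CARD('n)
           \<le> measure std_gaussian (cball u r)"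
proof -
  interpret prob_space "std_gaussian :: (real ^ 'n) measure" by (rule prob_space_std_gaussian)
  let ?c = "std_normal_density (R + 1) ^ CARD('n)"
  have R: "R \<ge> 0" using norm_ge_zero assms(1) by (rule order_trans)
  have ge: "ennreal ?c \<le> ennreal (\<Prod>i\<in>UNIV. std_normal_density (x $ i))" if "x \<in> cball u r" for x
  proof -
    have "norm x \<le> norm u + norm (x - u)" by norm
    with that assms have x: "norm x \<le> R + 1" by (simp add: dist_norm norm_minus_commute)
    have "std_normal_density (R + 1) \<le> std_normal_density (x $ i)" for i
    proof -
      have "\<bar>x $ i\<bar> \<le> R + 1" using component_le_norm_cart[of x i] x by linarith
      then have "(x $ i)\<^sup>2 \<le> (R + 1)\<^sup>2" using R by (simp add: abs_le_square_iff[symmetric])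
      then show ?thesis by (simp add: normal_density_def divide_right_mono)
    qed
    then have "(\<Prod>i\<in>(UNIV::'n set). std_normal_density (R + 1)) \<le> (\<Prod>i\<in>UNIV. std_normal_density (x $ i))"
      by (intro prod_mono) auto
    then show ?thesis by (intro ennreal_leI) simp
  qed
  have "ennreal (?c * unit_ball_vol (real CARD('n)) * r ^ CARD('n)) = ennreal ?c * emeasure lborel (cball u r)"
    using assms by (simp add: emeasure_cball ennreal_mult' mult.assoc)
  also have "\<dots> = (\<integral>\<^sup>+x. ennreal ?c * indicator (cball u r) x \<partial>lborel)"
    by (simp add: nn_integral_cmult_indicator)
  also have "\<dots> \<le> emeasure std_gaussian (cball u r)"
    unfolding std_gaussian_def
    by (subst emeasure_density) (auto intro!: nn_integral_mono ge simp: indicator_def)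
  finally show ?thesis by (simp add: emeasure_eq_measure)
qed

text \<open>The open set \<open>-N\<close> has full measure, and inner regularity exhausts it by
  compact sets.\<close>

lemma inner_compact_complement:
  fixes N :: "('a :: {second_countable_topology, complete_space}) set"
  assumes "prob_space M" "sets M = sets borel" "closed N" "emeasure M N = 0" "\<delta> > 0"
  obtains K where "compact K" "K \<inter> N = {}" "measure M (- K) \<le> \<delta>"
proof -
  interpret prob_space M by fact
  have sp: "space M = UNIV" using sets_eq_imp_space_eq[OF assms(2)] by simp
  have [measurable]: "N \<in> sets M" using assms by simp
  have "measure M (-N) = 1" using prob_compl[of N] assms(4) sp by (simp add: Compl_eq_Diff_UNIV emeasure_eq_measure)
  then have "1 = (SUP K \<in> {K. K \<subseteq> -N \<and> compact K}. emeasure M K)"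
    using inner_regular[of M "-N"] assms by (simp add: emeasure_eq_measure sp prob_space)
  \<comment> \<open>For \<delta> > 1 the left side truncates to 0, so the inequality remains
    valid.\<close>
  moreover have "ennreal (1 - \<delta>) < 1" using \<open>\<delta> > 0\<close> by (simp add: ennreal_less_one_iff)
  ultimately have "ennreal (1 - \<delta>) < (SUP K \<in> {K. K \<subseteq> -N \<and> compact K}. emeasure M K)"
    by simp
  then obtain K where K: "K \<subseteq> -N" "compact K" "ennreal (1 - \<delta>) < emeasure M K"
    unfolding less_SUP_iff by blast
  have "1 - \<delta> \<le> measure M K"
    using K(3) by (auto simp: emeasure_eq_measure ennreal_less_iff[symmetric] not_le[symmetric] intro: ennreal_leI)
  moreover have "measure M (- K) = 1 - measure M K"
    using prob_compl[of K] K(2) assms(2) sp by (simp add: Compl_eq_Diff_UNIV borel_compact)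
  ultimately show ?thesis using K by (intro that[of K]) auto
qed

section \<open>Deterministic bounds on residuals and the selection rule\<close>

text \<open>Replacing \<open>u\<close> by \<open>us\<close> changes the residual by at most
  \<open>\<sigma>0 * r\<close> and turns it into \<open>z\<close>, the vector \<mu> - v plus a
  multiple \<open>a\<close> of \<open>us\<close>. Since \<open>us\<close> stays at distance \<eta>/2
  from the span, a small \<open>z\<close> forces a small \<open>a\<close>; subtracting
  \<open>a *\<^sub>R us\<close> from \<open>z\<close> then bounds \<mu> - v.\<close>

lemma residual_bound:
  fixes \<mu> u us v :: "'a :: real_normed_vector"
  assumes V: "subspace V" "v \<in> V"
    and \<eta>: "\<eta> > 0" "\<And>w. w \<in> span (insert \<mu> V) \<Longrightarrow> \<eta> \<le> norm (u - w)"
    and r: "norm (us - u) \<le> r" "r \<le> \<eta> / 2" "r \<le> 1" and "norm u \<le> R" and "\<sigma>0 > 0"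
  shows "norm (\<mu> - v)
           \<le> (norm (\<mu> + \<sigma>0 *\<^sub>R u - v - \<sigma> *\<^sub>R us) + \<sigma>0 * r) * (1 + 2 * (R + 1) / \<eta>)"
proof -
  define a where "a = \<sigma>0 - \<sigma>"
  define z where "z = \<mu> - v + a *\<^sub>R us"
  define t where "t = norm (\<mu> + \<sigma>0 *\<^sub>R u - v - \<sigma> *\<^sub>R us) + \<sigma>0 * r"
  have "z = (\<mu> + \<sigma>0 *\<^sub>R u - v - \<sigma> *\<^sub>R us) + \<sigma>0 *\<^sub>R (us - u)"
    by (simp add: z_def a_def algebra_simps)
  then have "norm z \<le> norm (\<mu> + \<sigma>0 *\<^sub>R u - v - \<sigma> *\<^sub>R us) + norm (\<sigma>0 *\<^sub>R (us - u))"
    by (simp only: norm_triangle_ineq)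
  then have z: "norm z \<le> t"
    using r \<open>\<sigma>0 > 0\<close> by (simp add: t_def) (meson add_left_mono mult_left_mono order_trans less_imp_le)
  have a: "\<bar>a\<bar> \<le> 2 * t / \<eta>"
  proof (cases "a = 0")
    case True
    then show ?thesis using order_trans[OF norm_ge_zero z] \<eta>(1) by simp
  next
    case False
    \<comment> \<open>Chosen so that \<open>a *\<^sub>R (us - w)\<close> equals
      \<open>z\<close>.\<close>
    define w where "w = - (1 / a) *\<^sub>R (\<mu> - v)"
    have "w \<in> span (insert \<mu> V)"
      unfolding w_def using V by (intro span_scale span_diff) (auto intro: span_base)
    then have "\<eta> \<le> norm (u - w)" by (rule \<eta>)
    also have "\<dots> \<le> norm (us - w) + norm (us - u)" by norm
    finally have "\<eta> / 2 \<le> norm (us - w)" using r by simp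
    then have "\<bar>a\<bar> * (\<eta> / 2) \<le> \<bar>a\<bar> * norm (us - w)" by (rule mult_left_mono) simp
    also have "\<dots> = norm z"
      using False by (simp add: z_def w_def algebra_simps flip: norm_scaleR)
    finally show ?thesis using z \<eta>(1) by (simp add: field_simps)
  qed
  have us: "norm us \<le> R + 1"
    using norm_triangle_ineq[of "us - u" u] r assms by simp
  have "norm (\<mu> - v) = norm (z - a *\<^sub>R us)" by (simp add: z_def)
  also have "\<dots> \<le> norm z + \<bar>a\<bar> * norm us" by (metis norm_scaleR norm_triangle_ineq4)
  also have "\<dots> \<le> t + 2 * t / \<eta> * (R + 1)"
    using z a us \<eta>(1) norm_ge_zero[of z] by (intro add_mono mult_mono) auto
  also have "\<dots> = t * (1 + 2 * (R + 1) / \<eta>)" by (simp add: algebra_simps)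
  finally show ?thesis by (simp add: t_def)
qed

lemma criterion_le:
  assumes "lam \<ge> 0"
  shows "criterion X lam y us \<tau> \<le> (norm (y - sub_mult X \<tau> \<beta> - \<sigma> *\<^sub>R us))\<^sup>2 + lam * real (card \<tau>)"
  unfolding criterion_def
  by (rule cINF_lower2[of _ _ "(\<beta>, \<sigma>)"]) (auto intro!: bdd_belowI[of _ 0] simp: assms)

text \<open>A strict minimiser leaves \<open>sel\<close> a singleton to choose from.\<close>

lemma tau_hat_eqI:
  assumes "tie_breaking sel" "\<And>\<tau>. \<tau> \<noteq> \<tau>0 \<Longrightarrow> criterion X lam y us \<tau>0 < criterion X lam y us \<tau>"
  shows "tau_hat sel X lam y us = \<tau>0"
proof -
  have "{\<tau>. is_arg_min (criterion X lam y us) (\<lambda>_. True) \<tau>} = {\<tau>0}"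
  proof (intro equalityI subsetI)
    fix \<tau> assume "\<tau> \<in> {\<tau>. is_arg_min (criterion X lam y us) (\<lambda>_. True) \<tau>}"
    then have "\<not> criterion X lam y us \<tau>0 < criterion X lam y us \<tau>"
      by (simp add: is_arg_min_def)
    then show "\<tau> \<in> {\<tau>0}" using assms(2) by blast
  next
    fix \<tau> assume "\<tau> \<in> {\<tau>0}"
    moreover have "\<not> criterion X lam y us \<tau>' < criterion X lam y us \<tau>0" for \<tau>'
      using assms(2)[of \<tau>'] by (cases "\<tau>' = \<tau>0") auto
    ultimately show "\<tau> \<in> {\<tau>. is_arg_min (criterion X lam y us) (\<lambda>_. True) \<tau>}"
      by (simp add: is_arg_min_def)
  qed
  then show ?thesis using assms(1) unfolding tau_hat_def tie_breaking_def by (metis insert_not_empty singletonD)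
qed

section \<open>Identifiability and dimension counting\<close>

text \<open>A representing model no larger than \<tau>0 would be a second minimiser of the
  cardinality.\<close>

lemma identifiable_not_representable:
  assumes "identifiable X \<tau>0 \<beta>0" "\<tau> \<noteq> \<tau>0" "card \<tau> \<le> card \<tau>0"
  shows "sub_mult X \<tau> \<beta> \<noteq> sub_mult X \<tau>0 \<beta>0"
proof
  assume *: "sub_mult X \<tau> \<beta> = sub_mult X \<tau>0 \<beta>0"
  have "is_arg_min card (\<lambda>\<tau>'. \<exists>\<beta>. sub_mult X \<tau>' \<beta> = sub_mult X \<tau>0 \<beta>0) \<tau>0"
    using assms(1) by (auto simp: identifiable_def)
  then have "is_arg_min card (\<lambda>\<tau>'. \<exists>\<beta>. sub_mult X \<tau>' \<beta> = sub_mult X \<tau>0 \<beta>0) \<tau>"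
    using * assms(3) by (auto simp: is_arg_min_def)
  then show False using assms by (auto simp: identifiable_def)
qed

text \<open>The vector \<mu> and the columns indexed by \<tau> generate the span, so its dimension
  is at most \<open>card \<tau> + 1\<close>, below that of the ambient space.\<close>

lemma negligible_span_insert_range_sub_mult:
  fixes X :: "real ^ 'p ^ 'n"
  assumes "card \<tau> + 1 < CARD('n)"
  shows "negligible (span (insert \<mu> (range (sub_mult X \<tau>))))"
proof -
  let ?B = "insert \<mu> ((\<lambda>j. column j X) ` \<tau>)"
  have "sub_mult X \<tau> \<beta> \<in> span ?B" for \<beta>
    unfolding sub_mult_def by (intro span_sum span_scale span_base insertI2 imageI)
  moreover have "\<mu> \<in> span ?B" by (intro span_base insertI1)
  ultimately have "insert \<mu> (range (sub_mult X \<tau>)) \<subseteq> span ?B"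
    by blast
  then have "dim (insert \<mu> (range (sub_mult X \<tau>))) \<le> card ?B"
    by (intro dim_le_card) auto
  also have "\<dots> \<le> card \<tau> + 1"
    using card_image_le[of \<tau> "\<lambda>j. column j X"] card_insert_le_m1[of "card \<tau> + 1" "(\<lambda>j. column j X) ` \<tau>" \<mu>]
    by simp
  finally show ?thesis using assms by (intro negligible_lowdim) (simp add: dim_span)
qed

section \<open>From deterministic hits to the probability of a miss\<close>

text \<open>A miss lies in the measurable event \<open>?E\<close> that \<open>u\<close> leaves
  \<open>K\<close> or every draw avoids the ball around \<open>u\<close>. Integrating over
  \<open>u\<close>, each fiber above \<open>K\<close> costs at most \<open>(1 - q) ^ d\<close> by
  independence of the draws, and the other fibers cost at most 1.\<close>

lemma prob_miss_le:
  fixes X :: "real ^ 'p ^ 'n" and K :: "(real ^ 'n) set"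
  assumes K: "K \<in> sets borel"
    and hit: "\<And>u us. u \<in> K \<Longrightarrow> us \<in> cball u r
               \<Longrightarrow> tau_hat sel X lam (sub_mult X \<tau>0 \<beta>0 + \<sigma>0 *\<^sub>R u) us = \<tau>0"
    and q: "\<And>u. u \<in> K \<Longrightarrow> q \<le> measure std_gaussian (cball u r)" "q \<le> 1"
  shows "prob_miss sel X \<tau>0 \<beta>0 \<sigma>0 lam d \<le> (1 - q) ^ d + measure std_gaussian (- K)"
proof -
  interpret G: prob_space "std_gaussian :: (real ^ 'n) measure" by (rule prob_space_std_gaussian)
  interpret P: product_prob_space "\<lambda>_::nat. std_gaussian :: (real ^ 'n) measure" "{1..d}" ..
  interpret J: pair_prob_space "std_gaussian :: (real ^ 'n) measure"
      "Pi\<^sub>M {1..d} (\<lambda>_. std_gaussian :: (real ^ 'n) measure)" ..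
  let ?E = "{z \<in> space (joint_law d :: ((real ^ 'n) \<times> (nat \<Rightarrow> real ^ 'n)) measure).
              fst z \<notin> K \<or> (\<forall>b\<in>{1..d}. dist (fst z) (snd z b) > r)}"
  note K [measurable]
  have E: "?E \<in> sets (joint_law d)"
    unfolding joint_law_def by measurable
  have fiber: "emeasure (Pi\<^sub>M {1..d} (\<lambda>_. std_gaussian)) (Pair u -` ?E)
      \<le> ennreal ((1 - q) ^ d) + indicator (- K) u" for u
  proof (cases "u \<in> K")
    case True
    \<comment> \<open>Above a point of \<open>K\<close> the fiber is a box, so its measure is a
      \<open>d\<close>-fold product.\<close>
    have "Pair u -` ?E = Pi\<^sub>E {1..d} (\<lambda>_. - cball u r)"
      using True by (auto simp: joint_law_def space_pair_measure space_PiM PiE_def Pi_def Ball_def)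
    then have "emeasure (Pi\<^sub>M {1..d} (\<lambda>_. std_gaussian)) (Pair u -` ?E)
        = emeasure std_gaussian (- cball u r) ^ d"
      by (simp add: P.emeasure_PiM)
    also have "emeasure std_gaussian (- cball u r) = ennreal (1 - measure std_gaussian (cball u r))"
      using G.prob_compl[of "cball u r"] by (simp add: G.emeasure_eq_measure Compl_eq_Diff_UNIV)
    also have "\<dots> ^ d \<le> ennreal (1 - q) ^ d"
      using q(1)[OF True] by (intro power_mono ennreal_leI) auto
    also have "\<dots> = ennreal ((1 - q) ^ d)"
      using q(2) by (simp add: ennreal_power)
    finally show ?thesis by (simp add: True)
  next
    case False
    have "emeasure (Pi\<^sub>M {1..d} (\<lambda>_. std_gaussian)) (Pair u -` ?E) \<le> 1"
      by (rule P.P.measure_le_1)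
    also have "1 \<le> ennreal ((1 - q) ^ d) + indicator (- K) u"
      using False by (intro add_increasing) auto
    finally show ?thesis .
  qed
  have "prob_miss sel X \<tau>0 \<beta>0 \<sigma>0 lam d \<le> measure (joint_law d) ?E"
    unfolding prob_miss_def
    \<comment> \<open>Measurability of the miss event is not an issue: \<open>measure\<close> is 0 off the \<open>\<sigma>\<close>-algebra.\<close>
  proof (rule finite_measure.finite_measure_mono)
    show "finite_measure (joint_law d :: ((real ^ 'n) \<times> (nat \<Rightarrow> real ^ 'n)) measure)"
      unfolding joint_law_def by (rule J.finite_measure_axioms)
    show "?E \<in> sets (joint_law d)" by (rule E)
    have "dist u (us b) > r"
      if "u \<in> K" "b \<in> {1..d}"
        and "\<tau>0 \<notin> candidate_set sel X lam (sub_mult X \<tau>0 \<beta>0 + \<sigma>0 *\<^sub>R u) d us" for u us b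
      using hit[OF that(1), of "us b"] that(2,3) by (force simp: candidate_set_def not_le[symmetric])
    then show "{(u, us) \<in> space (joint_law d).
        \<tau>0 \<notin> candidate_set sel X lam (sub_mult X \<tau>0 \<beta>0 + \<sigma>0 *\<^sub>R u) d us} \<subseteq> ?E"
      by force
  qed
  also have "\<dots> \<le> (1 - q) ^ d + measure std_gaussian (- K)"
  proof -
    have "emeasure (joint_law d) ?E
        = (\<integral>\<^sup>+u. emeasure (Pi\<^sub>M {1..d} (\<lambda>_. std_gaussian)) (Pair u -` ?E) \<partial>std_gaussian)"
      using E unfolding joint_law_def by (rule P.P.emeasure_pair_measure_alt)
    also have "\<dots> \<le> (\<integral>\<^sup>+u. ennreal ((1 - q) ^ d) + indicator (- K) u \<partial>std_gaussian)"
      by (rule nn_integral_mono) (rule fiber)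
    also have "\<dots> = ennreal ((1 - q) ^ d) + emeasure std_gaussian (- K)"
      using G.emeasure_space_1 by (subst nn_integral_add) auto
    also have "\<dots> = ennreal ((1 - q) ^ d + measure std_gaussian (- K))"
      using q(2) by (simp add: G.emeasure_eq_measure)
    finally show ?thesis
      unfolding measure_def[of "joint_law d"] using q(2) by (intro enn2real_leI) auto
  qed
  finally show ?thesis .
qed

section \<open>Separation of the true model from its competitors\<close>

text \<open>The trial values \<beta>0 and \<sigma>0 leave the residual \<sigma>0 (u - us), which
  bounds the criterion at \<tau>0. A competitor of at most that size pays \<kappa> squared; a larger
  one pays at least one further \<open>lam\<close>, which already exceeds the squared
  residual.\<close>

lemma criterion_gap:
  fixes X :: "real ^ 'p ^ 'n"
  assumes lam: "\<sigma>0\<^sup>2 * r\<^sup>2 < lam" "\<sigma>0\<^sup>2 * r\<^sup>2 + lam * real (card \<tau>0) < \<kappa>\<^sup>2" and "\<kappa> > 0" "\<sigma>0 > 0"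
    and us: "norm (us - u) \<le> r"
    and res: "\<And>\<beta> \<sigma>. card \<tau> \<le> card \<tau>0 \<Longrightarrow>
       \<kappa> \<le> norm (sub_mult X \<tau>0 \<beta>0 + \<sigma>0 *\<^sub>R u - sub_mult X \<tau> \<beta> - \<sigma> *\<^sub>R us)"
  shows "criterion X lam (sub_mult X \<tau>0 \<beta>0 + \<sigma>0 *\<^sub>R u) us \<tau>0
       < criterion X lam (sub_mult X \<tau>0 \<beta>0 + \<sigma>0 *\<^sub>R u) us \<tau>"
proof -
  let ?y = "sub_mult X \<tau>0 \<beta>0 + \<sigma>0 *\<^sub>R u"
  have "lam > 0" using lam(1) by (rule le_less_trans[rotated]) simp
  have "\<sigma>0 *\<^sub>R u - \<sigma>0 *\<^sub>R us = - (\<sigma>0 *\<^sub>R (us - u))" by (simp add: algebra_simps)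
  then have "norm (?y - sub_mult X \<tau>0 \<beta>0 - \<sigma>0 *\<^sub>R us) = \<sigma>0 * norm (us - u)"
    using \<open>\<sigma>0 > 0\<close> by simp
  then have "(norm (?y - sub_mult X \<tau>0 \<beta>0 - \<sigma>0 *\<^sub>R us))\<^sup>2 \<le> \<sigma>0\<^sup>2 * r\<^sup>2"
    using us by (auto simp: power_mult_distrib intro!: mult_left_mono power_mono)
  then have upper: "criterion X lam ?y us \<tau>0 \<le> \<sigma>0\<^sup>2 * r\<^sup>2 + lam * real (card \<tau>0)"
    using criterion_le[of lam X ?y us \<tau>0 \<beta>0 \<sigma>0] \<open>lam > 0\<close> by simp
  obtain \<beta> \<sigma> where att: "criterion X lam ?y us \<tau>
      = (norm (?y - sub_mult X \<tau> \<beta> - \<sigma> *\<^sub>R us))\<^sup>2 + lam * real (card \<tau>)"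
    using criterion_attained[of X lam ?y us \<tau>] by blast
  show ?thesis
  proof (cases "card \<tau> \<le> card \<tau>0")
    case True
    have "\<kappa>\<^sup>2 \<le> (norm (?y - sub_mult X \<tau> \<beta> - \<sigma> *\<^sub>R us))\<^sup>2"
      using res[OF True] \<open>\<kappa> > 0\<close> by (intro power_mono) auto
    moreover have "0 \<le> lam * real (card \<tau>)" using \<open>lam > 0\<close> by simp
    ultimately show ?thesis using upper att lam(2) by linarith
  next
    case False
    then have "lam * (real (card \<tau>0) + 1) \<le> lam * real (card \<tau>)"
      using \<open>lam > 0\<close> by (intro mult_left_mono) auto
    then have "lam * real (card \<tau>0) + lam \<le> lam * real (card \<tau>)"
      by (simp add: distrib_left)
    moreover have "0 \<le> (norm (?y - sub_mult X \<tau> \<beta> - \<sigma> *\<^sub>R us))\<^sup>2" by simp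
    ultimately show ?thesis using upper att lam(1) by linarith
  qed
qed

text \<open>A finite union of closed Lebesgue-null sets is closed and Gaussian-null. A compact set
  inside its complement has positive distance from it.\<close>

lemma separated_compact_std_gaussian:
  fixes \<F> :: "(real ^ 'n) set set"
  assumes "finite \<F>" "\<And>F. F \<in> \<F> \<Longrightarrow> closed F" "\<And>F. F \<in> \<F> \<Longrightarrow> negligible F" "\<delta> > 0"
  obtains K R \<eta> where "compact K" "measure std_gaussian (- K) \<le> \<delta>" "\<eta> > 0"
    "\<And>u. u \<in> K \<Longrightarrow> norm u \<le> R" "\<And>u F w. u \<in> K \<Longrightarrow> F \<in> \<F> \<Longrightarrow> w \<in> F \<Longrightarrow> \<eta> \<le> norm (u - w)"
proof -
  let ?N = "\<Union>\<F>"
  have "closed ?N" using assms by auto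
  have "?N \<in> null_sets lborel"
    using \<open>closed ?N\<close> assms negligible_Union[of \<F>]
    by (auto simp: negligible_iff_null_sets null_sets_completion_iff)
  then have "emeasure std_gaussian ?N = 0"
    using absolutely_continuousI_density[of "\<lambda>x. ennreal (\<Prod>i\<in>UNIV. std_normal_density (x $ i))" lborel]
    unfolding std_gaussian_def absolutely_continuous_def by auto
  then obtain K where K: "compact K" "K \<inter> ?N = {}" "measure std_gaussian (- K) \<le> \<delta>"
    using inner_compact_complement[OF prob_space_std_gaussian sets_std_gaussian \<open>closed ?N\<close> _ \<open>\<delta> > 0\<close>]
    by blast
  obtain R where R: "\<forall>u\<in>K. norm u \<le> R"
    using compact_imp_bounded[OF K(1)] by (auto simp: bounded_iff)
  obtain \<eta> where "\<eta> > 0" "\<forall>u\<in>K. \<forall>w\<in>?N. \<eta> \<le> dist u w"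
    using separate_compact_closed[OF K(1) \<open>closed ?N\<close> K(2)] by blast
  with K R show ?thesis by (intro that[of K \<eta> R]) (auto simp: dist_norm)
qed

text \<open>Only finitely many models compete, so the union of their ranges is closed, and
  identifiability keeps the true mean outside it. This yields one distance for all
  competitors.\<close>

lemma identifiable_distance_pos:
  fixes X :: "real ^ 'p ^ 'n"
  assumes "identifiable X \<tau>0 \<beta>0"
  obtains D where "D > 0"
    "\<And>\<tau> \<beta>. \<tau> \<noteq> \<tau>0 \<Longrightarrow> card \<tau> \<le> card \<tau>0 \<Longrightarrow> D \<le> norm (sub_mult X \<tau>0 \<beta>0 - sub_mult X \<tau> \<beta>)"
proof -
  let ?N = "\<Union>\<tau>\<in>{\<tau>. \<tau> \<noteq> \<tau>0 \<and> card \<tau> \<le> card \<tau>0}. range (sub_mult X \<tau>)"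
  have "closed ?N"
    by (intro closed_UN ballI closed_subspace linear_subspace_image linear_sub_mult subspace_UNIV
        finite)
  moreover have "sub_mult X \<tau>0 \<beta>0 \<notin> ?N"
  proof
    assume "sub_mult X \<tau>0 \<beta>0 \<in> ?N"
    then obtain \<tau> \<beta> where "\<tau> \<noteq> \<tau>0" "card \<tau> \<le> card \<tau>0" "sub_mult X \<tau>0 \<beta>0 = sub_mult X \<tau> \<beta>"
      by blast
    then show False using identifiable_not_representable[OF assms, of \<tau> \<beta>] by simp
  qed
  ultimately have "\<exists>D>0. \<forall>x\<in>?N. D \<le> dist (sub_mult X \<tau>0 \<beta>0) x"
    by (rule separate_point_closed)
  then obtain D where "D > 0" "\<forall>x\<in>?N. D \<le> dist (sub_mult X \<tau>0 \<beta>0) x"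
    by auto
  then show ?thesis by (intro that[of D]) (auto simp: dist_norm)
qed

section \<open>The penalty interval and the limit in \<open>d\<close>\<close>

text \<open>Makes the lower end of the penalty interval positive. The logarithm is negative only for
  \<open>p = 1\<close>, where \<open>k = 1\<close> and \<open>n > 5\<close> keep the negative term
  small.\<close>

lemma ln_half_lower_bound:
  fixes k n p :: nat
  assumes "1 \<le> k" "k \<le> p" "k + 4 < n"
  shows "0 < 2 + 2 * (real k + 1) * (ln (real p / 2) / real n)"
proof (cases "p \<ge> 2")
  case True
  then have "0 \<le> ln (real p / 2)" by simp
  then show ?thesis by (intro add_pos_nonneg) auto
next
  case False
  then have "p = 1" "k = 1" using assms by auto
  have "ln (2::real) \<le> 1" using ln_le_minus_one[of 2] by simp
  then have "2 * (ln 2 / real n) < 1"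
    using assms by (simp add: field_simps)
  then show ?thesis by (simp add: \<open>p = 1\<close> \<open>k = 1\<close> ln_div)
qed

lemma limsup_geometric_bound:
  fixes f :: "nat \<Rightarrow> real"
  assumes "\<And>d. d \<ge> 1 \<Longrightarrow> f d \<le> a ^ d + c" "0 \<le> a" "a < 1"
  shows "limsup (\<lambda>d. ereal (f d)) \<le> ereal c"
proof -
  have "(\<lambda>d. ereal (a ^ d + c)) \<longlonglongrightarrow> ereal (0 + c)"
    using assms by (intro tendsto_intros LIMSEQ_realpow_zero)
  then have "limsup (\<lambda>d. ereal (a ^ d + c)) = ereal c"
    by (simp add: lim_imp_Limsup)
  moreover have "limsup (\<lambda>d. ereal (f d)) \<le> limsup (\<lambda>d. ereal (a ^ d + c))"
    using assms(1) by (intro Limsup_mono eventually_sequentiallyI[of 1]) auto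
  ultimately show ?thesis by simp
qed

section \<open>Choice of the constants and conclusion\<close>

theorem theorem1:
  fixes X :: "real ^ 'p ^ 'n"
    and \<tau>0 :: "'p set" and \<beta>0 :: "real ^ 'p" and \<sigma>0 :: real
    and sel :: "'p set set \<Rightarrow> 'p set"
    and \<delta> :: real
  assumes "\<tau>0 \<noteq> {}"
    and "\<sigma>0 > 0"
    and "identifiable X \<tau>0 \<beta>0"
    and "tie_breaking sel"
    and "CARD('n) - card \<tau>0 > 4"
    and "\<delta> > 0"
  shows "\<exists>\<gamma>::real. 0 < \<gamma> \<and> \<gamma> < 1 \<and>
    (\<forall>lam>0.
       lam \<in> {4 * real CARD('n) * \<gamma> powr (1/2)
                 * (2 + 2 * (real (card \<tau>0) + 1) * (ln (real CARD('p) / 2) / real CARD('n))) * \<sigma>0\<^sup>2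
              .. real CARD('n) * \<gamma> powr (1/4) / 6 * C_min X \<tau>0 \<beta>0} \<longrightarrow>
       (\<forall>d\<ge>1. prob_miss sel X \<tau>0 \<beta>0 \<sigma>0 lam d
                 \<le> (1 - \<gamma> ^ (CARD('n) - 1) / (real CARD('n) - 1)) ^ d + \<delta>) \<and>
       limsup (\<lambda>d. ereal (prob_miss sel X \<tau>0 \<beta>0 \<sigma>0 lam d)) \<le> ereal \<delta>)"
proof -
  let ?n = "CARD('n)" and ?\<mu> = "sub_mult X \<tau>0 \<beta>0"
  let ?L = "2 + 2 * (real (card \<tau>0) + 1) * (ln (real CARD('p) / 2) / real ?n)"
  let ?T = "{\<tau>. \<tau> \<noteq> \<tau>0 \<and> card \<tau> \<le> card \<tau>0}"
  let ?V = "\<lambda>\<tau>. range (sub_mult X \<tau>)"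
  \<comment> \<open>The truncated subtraction in the hypothesis exceeds 4, so it is a genuine
    difference and can be rewritten as a sum.\<close>
  have n: "card \<tau>0 + 4 < ?n" and k: "1 \<le> card \<tau>0"
    using assms(1,5) by (auto simp: Suc_le_eq card_gt_0_iff)
  have L: "?L > 0"
    using ln_half_lower_bound[of "card \<tau>0" "CARD('p)" ?n] n k by (simp add: card_mono)
  obtain D where D: "D > 0"
    "\<And>\<tau> \<beta>. \<tau> \<noteq> \<tau>0 \<Longrightarrow> card \<tau> \<le> card \<tau>0 \<Longrightarrow> D \<le> norm (?\<mu> - sub_mult X \<tau> \<beta>)"
    using identifiable_distance_pos[OF assms(3)] by blast
  define \<F> where "\<F> = (\<lambda>\<tau>. span (insert ?\<mu> (?V \<tau>))) ` ?T"
  have "finite \<F>" by (simp add: \<F>_def)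
  moreover have "closed F" if "F \<in> \<F>" for F
    using that by (auto simp: \<F>_def closed_span)
  moreover have "negligible F" if "F \<in> \<F>" for F
    using that n by (auto simp: \<F>_def intro!: negligible_span_insert_range_sub_mult)
  ultimately obtain K R \<eta> where K: "compact K" "measure std_gaussian (- K) \<le> \<delta>" "\<eta> > 0"
    "\<And>u. u \<in> K \<Longrightarrow> norm u \<le> R"
    "\<And>u F w. u \<in> K \<Longrightarrow> F \<in> \<F> \<Longrightarrow> w \<in> F \<Longrightarrow> \<eta> \<le> norm (u - w)"
    using separated_compact_std_gaussian[OF _ _ _ \<open>\<delta> > 0\<close>, of \<F>] by metis
  \<comment> \<open>\<open>K\<close> may be empty when \<delta> is large, and then \<open>R\<close>
    could be negative.\<close>
  define R' where "R' = max R 0"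
  define A where "A = 1 + 2 * (R' + 1) / \<eta>"
  \<comment> \<open>With \<open>A\<close> the factor from \<open>residual_bound\<close>, the
    residual plus \<open>\<sigma>0 * r\<close> is at least 2 \<kappa>. One \<kappa> is left after
    \<open>\<sigma>0 * r < \<kappa>\<close> is subtracted.\<close>
  define \<kappa> where "\<kappa> = D / (2 * A)"
  define C where "C = std_normal_density (R' + 1) ^ ?n * unit_ball_vol (real ?n)"
  have "A > 0" "\<kappa> > 0" "C > 0"
    using K(3) D(1) by (auto simp: A_def \<kappa>_def C_def R'_def normal_density_pos add_pos_nonneg)
  have small: "eventually (\<lambda>r. r < c) (at_right 0)" if "c > 0" for c :: real
    by (rule order_tendstoD(2)[OF tendsto_ident_at that])
  have "((\<lambda>r. \<sigma>0\<^sup>2 * r\<^sup>2 + real ?n * sqrt r / 6 * C_min X \<tau>0 \<beta>0 * real (card \<tau>0))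
      \<longlongrightarrow> \<sigma>0\<^sup>2 * 0\<^sup>2 + real ?n * sqrt 0 / 6 * C_min X \<tau>0 \<beta>0 * real (card \<tau>0)) (at_right 0)"
    by (intro tendsto_intros) auto
  then have "eventually (\<lambda>r. \<sigma>0\<^sup>2 * r\<^sup>2
      + real ?n * sqrt r / 6 * C_min X \<tau>0 \<beta>0 * real (card \<tau>0) < \<kappa>\<^sup>2) (at_right 0)"
    using \<open>\<kappa> > 0\<close> by (intro order_tendstoD(2)) auto
  moreover note small[OF zero_less_one] small[OF \<open>C > 0\<close>]
  moreover have "eventually (\<lambda>r. r < \<eta> / 2) (at_right 0)" using K(3) by (intro small) simp
  moreover have "eventually (\<lambda>r. r < \<kappa> / \<sigma>0) (at_right 0)"
    using \<open>\<kappa> > 0\<close> assms(2) by (intro small) simp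
  moreover have "eventually (\<lambda>r. r < 4 * real ?n * ?L) (at_right 0)"
    using L by (intro small mult_pos_pos) auto
  moreover have "eventually (\<lambda>r::real. r > 0) (at_right 0)" by (rule eventually_at_right_less)
  \<comment> \<open>In turn: \<open>r < C\<close> serves the ball probability,
    \<open>\<eta> / 2\<close> and \<open>\<kappa> / \<sigma>0\<close> the residual bound, and
    \<open>4 * real ?n * ?L\<close> the lower end of the penalty interval. The last inequality
    handles its upper end, which is of order \<open>sqrt r\<close>.\<close>
  ultimately have ev: "eventually (\<lambda>r::real. r > 0 \<and> r < 1 \<and> r < C \<and> r < \<eta> / 2 \<and> r < \<kappa> / \<sigma>0
      \<and> r < 4 * real ?n * ?L \<and> \<sigma>0\<^sup>2 * r\<^sup>2
      + real ?n * sqrt r / 6 * C_min X \<tau>0 \<beta>0 * real (card \<tau>0) < \<kappa>\<^sup>2) (at_right 0)"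
    by eventually_elim blast
  then obtain r where r: "r > 0" "r < 1" "r < C" "r < \<eta> / 2" "r < \<kappa> / \<sigma>0" "r < 4 * real ?n * ?L"
    "\<sigma>0\<^sup>2 * r\<^sup>2 + real ?n * sqrt r / 6 * C_min X \<tau>0 \<beta>0 * real (card \<tau>0) < \<kappa>\<^sup>2"
    using eventually_happens[OF ev] trivial_limit_at_right_real[of "0::real"] by blast
  define \<gamma> where "\<gamma> = r\<^sup>2"
  define q where "q = \<gamma> ^ (?n - 1) / (real ?n - 1)"
  have \<gamma>: "0 < \<gamma>" "\<gamma> < 1" using r by (auto simp: \<gamma>_def power_less_one_iff abs_square_less_1)
  have powr: "\<gamma> powr (1/2) = r" "\<gamma> powr (1/4) = sqrt r"
    using r(1) by (simp_all add: \<gamma>_def powr_powr powr_half_sqrt[symmetric] flip: powr_numeral)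
  have "q \<le> \<gamma> ^ (?n - 1)"
    using n \<gamma> by (simp add: q_def divide_le_eq)
  \<comment> \<open>Since 2(n-1) = n + (n-2), the factor \<open>r ^ (?n - 2)\<close> is spare; it is
    at most \<open>r\<close>, hence below \<open>C\<close>.\<close>
  also have "\<gamma> ^ (?n - 1) = r ^ ?n * r ^ (?n - 2)"
    using n by (simp add: \<gamma>_def flip: power_mult power_add) (auto intro!: arg_cong[of _ _ "\<lambda>k. r ^ k"])
  also have "\<dots> \<le> r ^ ?n * C"
  proof (intro mult_left_mono)
    have "r ^ (?n - 2) \<le> r ^ 1" using r n by (intro power_decreasing) auto
    then show "r ^ (?n - 2) \<le> C" using r by simp
  qed (use r in auto)
  finally have qC: "q \<le> C * r ^ ?n" by (simp add: mult.commute)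
  have q: "0 < q" "q < 1"
  proof -
    show "0 < q" using \<gamma> n by (simp add: q_def)
    have "\<gamma> ^ (?n - 1) < 1" using power_strict_mono[of \<gamma> 1 "?n - 1"] \<gamma> n by simp
    then show "q < 1" using \<open>q \<le> \<gamma> ^ (?n - 1)\<close> by simp
  qed
  have ball: "q \<le> measure std_gaussian (cball u r)" if "u \<in> K" for u
  proof -
    have "norm u \<le> R'" using K(4)[OF that] by (simp add: R'_def)
    then have "C * r ^ ?n \<le> measure std_gaussian (cball u r)"
      unfolding C_def using r by (intro std_gaussian_cball_ge) auto
    with qC show ?thesis by (rule order_trans)
  qed
  have main: "prob_miss sel X \<tau>0 \<beta>0 \<sigma>0 lam d \<le> (1 - q) ^ d + \<delta>"
    if lam: "lam \<in> {4 * real ?n * \<gamma> powr (1/2) * ?L * \<sigma>0\<^sup>2 .. real ?n * \<gamma> powr (1/4) / 6 * C_min X \<tau>0 \<beta>0}"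
    for lam d
  proof -
    \<comment> \<open>The right side is the lower end of the penalty interval, the left side the
      squared residual bound for \<tau>0.\<close>
    have "r * (r * \<sigma>0\<^sup>2) < (4 * real ?n * ?L) * (r * \<sigma>0\<^sup>2)"
      using r assms(2) by (intro mult_strict_right_mono) auto
    then have lam1: "\<sigma>0\<^sup>2 * r\<^sup>2 < lam"
      using lam unfolding powr by (simp add: power2_eq_square mult_ac)
    have "lam * real (card \<tau>0) \<le> real ?n * sqrt r / 6 * C_min X \<tau>0 \<beta>0 * real (card \<tau>0)"
      using lam unfolding powr by (intro mult_right_mono) auto
    then have lam2: "\<sigma>0\<^sup>2 * r\<^sup>2 + lam * real (card \<tau>0) < \<kappa>\<^sup>2" using r(7) by linarith
    have hit: "tau_hat sel X lam (?\<mu> + \<sigma>0 *\<^sub>R u) us = \<tau>0" if u: "u \<in> K" and us: "us \<in> cball u r" for u us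
    proof (rule tau_hat_eqI[OF assms(4)], rule criterion_gap[OF lam1 lam2 \<open>\<kappa> > 0\<close> assms(2)])
      show usr: "norm (us - u) \<le> r" using us by (simp add: dist_norm norm_minus_commute)
      fix \<tau> \<beta> \<sigma> assume \<tau>: "\<tau> \<noteq> \<tau>0" "card \<tau> \<le> card \<tau>0"
      let ?res = "norm (?\<mu> + \<sigma>0 *\<^sub>R u - sub_mult X \<tau> \<beta> - \<sigma> *\<^sub>R us)"
      have "norm (?\<mu> - sub_mult X \<tau> \<beta>) \<le> (?res + \<sigma>0 * r) * (1 + 2 * (R' + 1) / \<eta>)"
      proof (rule residual_bound)
        show "subspace (?V \<tau>)"
          by (intro linear_subspace_image linear_sub_mult subspace_UNIV)
        show "\<eta> \<le> norm (u - w)" if "w \<in> span (insert ?\<mu> (?V \<tau>))" for w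
          using K(5)[OF u _ that] \<tau> by (auto simp: \<F>_def)
        show "norm u \<le> R'" using K(4)[OF u] by (simp add: R'_def)
      qed (use usr r K(3) assms(2) in auto)
      then have "D \<le> (?res + \<sigma>0 * r) * A"
        using D(2)[OF \<tau>, of \<beta>] by (simp add: A_def)
      moreover have "D = (\<kappa> + \<kappa>) * A" using \<open>A > 0\<close> by (simp add: \<kappa>_def field_simps)
      ultimately have "\<kappa> + \<kappa> \<le> ?res + \<sigma>0 * r" using \<open>A > 0\<close> by simp
      moreover have "\<sigma>0 * r < \<kappa>" using r(5) assms(2) by (simp add: field_simps)
      ultimately show "\<kappa> \<le> ?res" by linarith
    qed
    have "prob_miss sel X \<tau>0 \<beta>0 \<sigma>0 lam d \<le> (1 - q) ^ d + measure std_gaussian (- K)"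
      using K(1) q(2) by (intro prob_miss_le[OF _ hit ball]) (auto simp: borel_compact)
    then show ?thesis using K(2) by linarith
  qed
  show ?thesis
  proof (intro exI[of _ \<gamma>] conjI allI impI)
    fix lam :: real
    assume lam: "lam \<in> {4 * real ?n * \<gamma> powr (1/2) * ?L * \<sigma>0\<^sup>2 .. real ?n * \<gamma> powr (1/4) / 6 * C_min X \<tau>0 \<beta>0}"
    show "prob_miss sel X \<tau>0 \<beta>0 \<sigma>0 lam d \<le> (1 - \<gamma> ^ (?n - 1) / (real ?n - 1)) ^ d + \<delta>" for d
      using main[OF lam] by (simp add: q_def)
    \<comment> \<open>Positivity of \<open>q\<close> makes the geometric term vanish in the
      limit.\<close>
    show "limsup (\<lambda>d. ereal (prob_miss sel X \<tau>0 \<beta>0 \<sigma>0 lam d)) \<le> ereal \<delta>"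
      using main[OF lam] q by (intro limsup_geometric_bound[of _ "1 - q"]) auto
  qed (use \<gamma> in auto)
qed

end
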